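(* Let $0\le\theta\le1$ and let $(X,Y)$ have Gumbel's bivariate exponential distribution (GBED-I) with parameter $\theta$, that is, joint distribution function $F_{12}(x,y)=1-e^{-x}-e^{-y}+e^{-(x+y+\theta xy)}$ for $x,y>0$ (and $0$ otherwise), so that both marginals are standard exponential. Let $\kappa(\theta)=\kappa(X,Y)$ be Bergsma's covariance of $(X,Y)$, and let $G(x)=\int_1^\infty \frac{e^{-xt}}{t}\,dt$ for $x>0$. Then $$\kappa(\theta)=\begin{cases}0, & \theta=0,\\[4pt] \dfrac{1}{2\theta}e^{2/\theta}G(2/\theta)+\dfrac14-\dfrac{2}{\theta}e^{4/\theta}G(4/\theta), & \theta\neq0.\end{cases}$$
   Context: For a distribution function $F$ on $\mathbb{R}$ with finite mean, with $Z_1,Z_2$ i.i.d. $F$, define $h_F(z_1,z_2)=-\tfrac12\,\mathbb{E}\big(|z_1-z_2|-|z_1-Z_2|-|Z_1-z_2|+|Z_1-Z_2|\big)$. For a bivariate random variable $(X,Y)$ with marginal distribution functions $F_1,F_2$ of finite variance, Bergsma's covariance is $\kappa(X,Y)=\mathbb{E}[h_{F_1}(X_1,X_2)\,h_{F_2}(Y_1,Y_2)]$, where $(X_1,Y_1),(X_2,Y_2)$ are i.i.d. copies of $(X,Y)$. *)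

theory Defs
  imports "HOL-Probability.Probability"
begin

(* For a distribution function F, interval_measure F is the law on the reals with distribution
   function F, and its product with itself is the law of an i.i.d. pair (Z1, Z2). *)
definition bergsma_h :: "(real \<Rightarrow> real) \<Rightarrow> real \<Rightarrow> real \<Rightarrow> real" where
  "bergsma_h F z1 z2 =
     - (1/2) * (\<integral>(w1, w2). (\<bar>z1 - z2\<bar> - \<bar>z1 - w2\<bar> - \<bar>w1 - z2\<bar> + \<bar>w1 - w2\<bar>)
                  \<partial>(interval_measure F \<Otimes>\<^sub>M interval_measure F))"

definition distribution_function :: "'a measure \<Rightarrow> ('a \<Rightarrow> real) \<Rightarrow> real \<Rightarrow> real" where
  "distribution_function M X = cdf (distr M borel X)"

(* The i.i.d. copies (X1, Y1), (X2, Y2) are realised on the product of M with itself,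
   by evaluating (X, Y) at the first and at the second coordinate. *)
definition bergsma_cov :: "'a measure \<Rightarrow> ('a \<Rightarrow> real) \<Rightarrow> ('a \<Rightarrow> real) \<Rightarrow> real" where
  "bergsma_cov M X Y =
     (\<integral>(\<omega>1, \<omega>2). bergsma_h (distribution_function M X) (X \<omega>1) (X \<omega>2)
                 * bergsma_h (distribution_function M Y) (Y \<omega>1) (Y \<omega>2)
        \<partial>(M \<Otimes>\<^sub>M M))"

definition gumbel_cdf :: "real \<Rightarrow> real \<Rightarrow> real \<Rightarrow> real" where
  "gumbel_cdf \<theta> x y =
     (if x > 0 \<and> y > 0
      then 1 - exp (- x) - exp (- y) + exp (- (x + y + \<theta> * x * y))
      else 0)"

definition gumbel_distributed ::
    "'a measure \<Rightarrow> ('a \<Rightarrow> real) \<Rightarrow> ('a \<Rightarrow> real) \<Rightarrow> real \<Rightarrow> bool" where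
  "gumbel_distributed M X Y \<theta> \<longleftrightarrow>
     X \<in> borel_measurable M \<and> Y \<in> borel_measurable M \<and>
     (\<forall>x y. measure M {\<omega> \<in> space M. X \<omega> \<le> x \<and> Y \<omega> \<le> y} = gumbel_cdf \<theta> x y)"

(* Only meaningful for x > 0. *)
definition G :: "real \<Rightarrow> real" where
  "G x = (LBINT t=1..\<infinity>. exp (- x * t) / t)"

end

theory Submission
  imports Defs "HOL-Real_Asymp.Real_Asymp"
begin

text \<open>
  The kernel \<open>h\<^sub>F\<close> is a mixture of products of centred indicators. Indeed
  \<open>\<bar>a - b\<bar>\<close> is the integral over \<open>t\<close> of the squared difference of
  the indicators \<open>1(a \<le> t)\<close> and \<open>1(b \<le> t)\<close>, so the alternating sum
  of four distances that defines \<open>h\<^sub>F\<close> polarises into the product of two such differences.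
  Averaging over the i.i.d. pair replaces the second indicator in each factor by its mean, and
  \<open>h\<^sub>F z1 z2\<close> becomes the integral of
  \<open>(1(z1 \<le> t) - F t) * (1(z2 \<le> t) - F t)\<close> over \<open>t\<close> (\<open>bergsma_h_cdf\<close>).

  Inserting this for both coordinates and exchanging integrals, the independence of the two copies
  turns the expectation at fixed thresholds \<open>(s, t)\<close> into the square of the covariance of
  \<open>1(X \<le> s)\<close> and \<open>1(Y \<le> t)\<close>. Hence \<open>\<kappa>(X, Y)\<close> is
  the integral of \<open>(F\<^sub>1\<^sub>2 - F\<^sub>1 F\<^sub>2)\<^sup>2\<close> over the plane, for any pair
  with finite means (\<open>bergsma_cov_eq_integral_square\<close>).

  For Gumbel's law the difference is \<open>exp (-(x + y + \<theta> x y)) - exp (-(x + y))\<close> on the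
  positive quadrant. Its square integrates in \<open>y\<close> to \<open>exp (-2 x)\<close> times a
  combination of \<open>1 / (x + 1/\<theta>)\<close>, \<open>1 / (x + 2/\<theta>)\<close> and a constant, and the
  substitution \<open>x = c t - c\<close> with \<open>c = 1/\<theta>\<close> or \<open>c = 2/\<theta>\<close> turns the
  integrals in \<open>x\<close> into values of \<open>G\<close> (\<open>has_integral_exp_over_shift\<close>).
\<close>

section \<open>Distances as integrals of indicators\<close>

text \<open>A real-valued function of two real arguments, so that joint measurability in the
  observation and the threshold is available to the measurability prover.\<close>

definition jump :: "real \<Rightarrow> real \<Rightarrow> real" where
  "jump z t = (if z \<le> t then 1 else 0)"

lemma jump_measurable [measurable]:
  assumes [measurable]: "f \<in> borel_measurable M" "g \<in> borel_measurable M"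
  shows "(\<lambda>x. jump (f x) (g x)) \<in> borel_measurable M"
  unfolding jump_def by measurable

lemma has_integral_jump_diff_square:
  "has_bochner_integral lborel (\<lambda>t. (jump a t - jump b t)\<^sup>2) \<bar>a - b\<bar>"
proof -
  have "has_bochner_integral lborel (indicator {min a b..<max a b} :: real \<Rightarrow> real)
          (measure lborel {min a b..<max a b})"
    by (rule has_bochner_integral_real_indicator) auto
  also have "measure lborel {min a b..<max a b} = \<bar>a - b\<bar>"
    by (simp add: min_def max_def)
  also have "(indicator {min a b..<max a b} :: real \<Rightarrow> real) = (\<lambda>t. (jump a t - jump b t)\<^sup>2)"
    by (auto simp: jump_def fun_eq_iff indicator_def)
  finally show ?thesis .
qed

lemma nn_integral_abs_jump_diff:
  "(\<integral>\<^sup>+t. ennreal \<bar>jump a t - jump b t\<bar> \<partial>lborel) = ennreal \<bar>a - b\<bar>"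
proof -
  have "\<bar>jump a t - jump b t\<bar> = (jump a t - jump b t)\<^sup>2" for t
    by (auto simp: jump_def)
  then show ?thesis
    using has_integral_jump_diff_square[of a b]
    by (simp add: nn_integral_eq_integral has_bochner_integral_iff)
qed

text \<open>Polarisation: with \<open>p, q, r, s\<close> the indicators for \<open>z1, w1, z2, w2\<close>,
  the product \<open>(p - q) * (r - s)\<close> is \<open>-1/2\<close> times
  \<open>(p - r)\<^sup>2 - (p - s)\<^sup>2 - (q - r)\<^sup>2 + (q - s)\<^sup>2\<close>, and each square integrates to a
  distance.\<close>
lemma has_integral_jump_diff_product:
  "has_bochner_integral lborel (\<lambda>t. (jump z1 t - jump w1 t) * (jump z2 t - jump w2 t))
     (- (1/2) * (\<bar>z1 - z2\<bar> - \<bar>z1 - w2\<bar> - \<bar>w1 - z2\<bar> + \<bar>w1 - w2\<bar>))"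
proof -
  have "has_bochner_integral lborel
     (\<lambda>t. - (1/2) * ((jump z1 t - jump z2 t)\<^sup>2 - (jump z1 t - jump w2 t)\<^sup>2
                     - (jump w1 t - jump z2 t)\<^sup>2 + (jump w1 t - jump w2 t)\<^sup>2))
     (- (1/2) * (\<bar>z1 - z2\<bar> - \<bar>z1 - w2\<bar> - \<bar>w1 - z2\<bar> + \<bar>w1 - w2\<bar>))"
    by (intro has_bochner_integral_mult_right has_bochner_integral_add has_bochner_integral_diff
          has_integral_jump_diff_square)
  then show ?thesis
    by (rule has_bochner_integral_cong[THEN iffD1, rotated 3])
       (auto simp: power2_eq_square algebra_simps)
qed

section \<open>The kernel as a mixture of centred indicators\<close>

lemma (in pair_sigma_finite) has_integral_product:
  fixes f :: "'a \<Rightarrow> real" and g :: "'b \<Rightarrow> real"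
  assumes "integrable M1 f" "integrable M2 g"
  shows "has_bochner_integral (M1 \<Otimes>\<^sub>M M2) (\<lambda>(x, y). f x * g y)
           ((\<integral>x. f x \<partial>M1) * (\<integral>y. g y \<partial>M2))"
proof -
  have [measurable]: "f \<in> borel_measurable M1" "g \<in> borel_measurable M2"
    using assms by auto
  have int: "integrable (M1 \<Otimes>\<^sub>M M2) (\<lambda>(x, y). f x * g y)"
    by (rule Fubini_integrable) (use assms in \<open>auto simp: abs_mult\<close>)
  show ?thesis
    using integral_fst[OF int] by (simp add: has_bochner_integral_iff int)
qed

lemma (in real_distribution) interval_measure_cdf: "interval_measure (cdf M) = M"
proof (rule cdf_unique)
  show "real_distribution (interval_measure (cdf M))"
    by (rule real_distribution_interval_measure)
       (auto intro: cdf_nondecreasing cdf_is_right_cont cdf_lim_at_bot cdf_lim_at_top_prob)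
  show "real_distribution M" ..
  show "cdf (interval_measure (cdf M)) = cdf M"
    by (rule cdf_interval_measure)
       (auto intro: cdf_nondecreasing cdf_is_right_cont cdf_lim_at_bot)
qed

lemma (in real_distribution) cdf_borel_measurable [measurable]: "cdf M \<in> borel_measurable borel"
  by (rule borel_measurable_mono) (auto simp: mono_def cdf_nondecreasing)

lemma (in real_distribution) has_integral_jump:
  "has_bochner_integral M (\<lambda>w. jump w t) (cdf M t)"
proof -
  have "has_bochner_integral M (indicator {..t} :: real \<Rightarrow> real) (measure M {..t})"
    by (rule has_bochner_integral_real_indicator) (auto simp: emeasure_eq_measure)
  also have "(indicator {..t} :: real \<Rightarrow> real) = (\<lambda>w. jump w t)"
    by (auto simp: jump_def fun_eq_iff)
  finally show ?thesis by (simp add: cdf_def)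
qed

text \<open>Average the polarisation identity over the i.i.d. pair \<open>(w1, w2)\<close> and exchange the
  integrals: at fixed \<open>t\<close> the two factors are independent, with means
  \<open>jump z1 t - cdf M t\<close> and \<open>jump z2 t - cdf M t\<close>. For Fubini's theorem, one factor
  is bounded by \<open>1\<close> and the other one integrates to \<open>\<bar>z1 - w1\<bar>\<close>, which has
  finite mean.\<close>
lemma (in real_distribution) bergsma_h_cdf:
  assumes int: "integrable M (\<lambda>w. w)"
  shows "has_bochner_integral lborel (\<lambda>t. (jump z1 t - cdf M t) * (jump z2 t - cdf M t))
           (bergsma_h (cdf M) z1 z2)"
proof -
  interpret MM: pair_prob_space M M ..
  interpret MML: pair_sigma_finite "M \<Otimes>\<^sub>M M" lborel ..
  define \<phi> where "\<phi> = (\<lambda>(w1, w2) t. (jump z1 t - jump w1 t) * (jump z2 t - jump w2 t))"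
  have \<phi>_measurable [measurable]: "case_prod \<phi> \<in> borel_measurable ((M \<Otimes>\<^sub>M M) \<Otimes>\<^sub>M lborel)"
    unfolding \<phi>_def case_prod_unfold by measurable
  have "(\<integral>\<^sup>+p. ennreal (norm (case_prod \<phi> p)) \<partial>((M \<Otimes>\<^sub>M M) \<Otimes>\<^sub>M lborel))
      = (\<integral>\<^sup>+w. \<integral>\<^sup>+t. ennreal \<bar>\<phi> w t\<bar> \<partial>lborel \<partial>(M \<Otimes>\<^sub>M M))"
    by (subst lborel.nn_integral_fst[symmetric]) auto
  also have "\<dots> \<le> (\<integral>\<^sup>+w. \<integral>\<^sup>+t. ennreal \<bar>jump z1 t - jump (fst w) t\<bar> \<partial>lborel \<partial>(M \<Otimes>\<^sub>M M))"
    by (intro nn_integral_mono ennreal_leI) (auto simp: \<phi>_def jump_def)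
  also have "\<dots> = (\<integral>\<^sup>+w. ennreal \<bar>z1 - fst w\<bar> \<partial>(M \<Otimes>\<^sub>M M))"
    by (simp add: nn_integral_abs_jump_diff)
  also have "\<dots> = (\<integral>\<^sup>+w1. \<integral>\<^sup>+w2. ennreal \<bar>z1 - w1\<bar> \<partial>M \<partial>M)"
    by (subst nn_integral_fst[symmetric]) auto
  also have "\<dots> = (\<integral>\<^sup>+w. ennreal \<bar>z1 - w\<bar> \<partial>M)"
    by (simp add: emeasure_space_1[simplified])
  also have "\<dots> < \<infinity>"
    using int by (simp add: nn_integral_eq_integral)
  finally have \<phi>_int: "integrable ((M \<Otimes>\<^sub>M M) \<Otimes>\<^sub>M lborel) (case_prod \<phi>)"
    by (intro integrableI_bounded) auto
  have inner: "(\<integral>w. \<phi> w t \<partial>(M \<Otimes>\<^sub>M M)) = (jump z1 t - cdf M t) * (jump z2 t - cdf M t)" for t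
  proof -
    have *: "has_bochner_integral M (\<lambda>w. jump z t - jump w t) (jump z t - cdf M t)" for z
      using has_bochner_integral_diff[OF _ has_integral_jump, of "\<lambda>_. jump z t" "jump z t"]
      by (simp add: has_bochner_integral_iff prob_space[simplified])
    show ?thesis
      using MM.has_integral_product[of "\<lambda>w. jump z1 t - jump w t" "\<lambda>w. jump z2 t - jump w t"] *
      by (simp add: has_bochner_integral_iff \<phi>_def case_prod_unfold)
  qed
  have outer: "(\<integral>w. (\<integral>t. \<phi> w t \<partial>lborel) \<partial>(M \<Otimes>\<^sub>M M)) = bergsma_h (cdf M) z1 z2"
    using has_integral_jump_diff_product
    by (simp add: bergsma_h_def interval_measure_cdf \<phi>_def case_prod_unfold
          has_bochner_integral_iff)
  show ?thesis
    using MML.integrable_snd[OF \<phi>_int] MML.Fubini_integral[OF \<phi>_int]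
    by (simp add: has_bochner_integral_iff inner outer)
qed

text \<open>The domination needed for the exchange of integrals below. By Jensen's inequality the
  centred indicator is bounded by the average of \<open>\<bar>jump z t - jump w t\<bar>\<close> over an
  independent copy \<open>w\<close>, so the double integral is at most the mean distance of two
  independent copies.\<close>
lemma (in real_distribution) nn_integral_centred_jump_finite:
  assumes int: "integrable M (\<lambda>w. w)"
  shows "(\<integral>\<^sup>+z. \<integral>\<^sup>+t. ennreal \<bar>jump z t - cdf M t\<bar> \<partial>lborel \<partial>M) < \<infinity>"
proof -
  interpret Mt: pair_sigma_finite M lborel ..
  have abs_le: "ennreal \<bar>jump z t - cdf M t\<bar> \<le> (\<integral>\<^sup>+w. ennreal \<bar>jump z t - jump w t\<bar> \<partial>M)" for z t
  proof -
    have int_diff: "integrable M (\<lambda>w. jump z t - jump w t)"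
      using has_integral_jump[of t] by (auto simp: has_bochner_integral_iff)
    have "(\<integral>w. jump z t - jump w t \<partial>M) = jump z t - cdf M t"
      using has_integral_jump[of t] by (simp add: has_bochner_integral_iff prob_space[simplified])
    then show ?thesis
      using integral_norm_bound_ennreal[OF int_diff] by simp
  qed
  have "(\<integral>\<^sup>+z. \<integral>\<^sup>+t. ennreal \<bar>jump z t - cdf M t\<bar> \<partial>lborel \<partial>M)
      \<le> (\<integral>\<^sup>+z. \<integral>\<^sup>+t. \<integral>\<^sup>+w. ennreal \<bar>jump z t - jump w t\<bar> \<partial>M \<partial>lborel \<partial>M)"
    by (intro nn_integral_mono abs_le)
  also have "\<dots> = (\<integral>\<^sup>+z. \<integral>\<^sup>+w. \<integral>\<^sup>+t. ennreal \<bar>jump z t - jump w t\<bar> \<partial>lborel \<partial>M \<partial>M)"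
    by (subst Mt.Fubini') auto
  also have "\<dots> = (\<integral>\<^sup>+z. \<integral>\<^sup>+w. ennreal \<bar>z - w\<bar> \<partial>M \<partial>M)"
    by (simp add: nn_integral_abs_jump_diff)
  also have "\<dots> \<le> (\<integral>\<^sup>+z. \<integral>\<^sup>+w. ennreal \<bar>z\<bar> + ennreal \<bar>w\<bar> \<partial>M \<partial>M)"
    by (intro nn_integral_mono) (simp flip: ennreal_plus)
  also have "\<dots> = (\<integral>\<^sup>+z. ennreal \<bar>z\<bar> \<partial>M) + (\<integral>\<^sup>+w. ennreal \<bar>w\<bar> \<partial>M)"
    by (simp add: nn_integral_add emeasure_space_1[simplified])
  also have "\<dots> < \<infinity>"
    using int by (simp add: nn_integral_eq_integral)
  finally show ?thesis .
qed

section \<open>Bergsma's covariance from distribution functions\<close>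

text \<open>Bergsma's covariance is the squared \<open>L\<^sup>2\<close> distance between the joint distribution
  function and the product of the marginal ones. Fubini's theorem applies because, in the integrand
  \<open>a s \<omega>1 * b t \<omega>1 * (a s \<omega>2 * b t \<omega>2)\<close>, with \<open>a\<close> and
  \<open>b\<close> the centred indicators of \<open>X\<close> and \<open>Y\<close>, bounding by \<open>1\<close>
  the factors \<open>b t \<omega>1\<close> and \<open>a s \<omega>2\<close> leaves a dominating function whose two
  factors involve different copies, so that its integral is a product of two finite first-order
  quantities.\<close>
lemma (in prob_space) bergsma_cov_eq_integral_square:
  fixes X Y :: "'a \<Rightarrow> real"
  assumes X: "integrable M X" and Y: "integrable M Y"
  defines "F \<equiv> distribution_function M X" and "F' \<equiv> distribution_function M Y"
  shows "has_bochner_integral (lborel \<Otimes>\<^sub>M lborel)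
           (\<lambda>(s, t). (prob {\<omega> \<in> space M. X \<omega> \<le> s \<and> Y \<omega> \<le> t} - F s * F' t)\<^sup>2)
           (bergsma_cov M X Y)"
proof -
  have [measurable]: "X \<in> borel_measurable M" "Y \<in> borel_measurable M"
    using X Y by auto
  interpret PX: real_distribution "distr M borel X" by simp
  interpret PY: real_distribution "distr M borel Y" by simp
  have F_eq: "F = cdf (distr M borel X)" "F' = cdf (distr M borel Y)"
    by (simp_all add: F_def F'_def distribution_function_def)
  have [measurable]: "F \<in> borel_measurable borel" "F' \<in> borel_measurable borel"
    unfolding F_eq by measurable
  have intX: "integrable (distr M borel X) (\<lambda>w. w)" and intY: "integrable (distr M borel Y) (\<lambda>w. w)"
    using X Y by (auto simp: integrable_distr_eq)
  define a where "a s \<omega> = jump (X \<omega>) s - F s" for s \<omega>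
  define b where "b t \<omega> = jump (Y \<omega>) t - F' t" for t \<omega>
  have a_measurable [measurable]: "(\<lambda>x. a (f x) (g x)) \<in> borel_measurable N"
    if [measurable]: "f \<in> borel_measurable N" "g \<in> N \<rightarrow>\<^sub>M M" for f g and N :: "'c measure"
    unfolding a_def by measurable
  have b_measurable [measurable]: "(\<lambda>x. b (f x) (g x)) \<in> borel_measurable N"
    if [measurable]: "f \<in> borel_measurable N" "g \<in> N \<rightarrow>\<^sub>M M" for f g and N :: "'c measure"
    unfolding b_def by measurable
  have a_le: "\<bar>a s \<omega>\<bar> \<le> 1" for s \<omega>
    using PX.cdf_nonneg[of s] PX.cdf_bounded_prob[of s] by (auto simp: a_def jump_def F_eq)
  have b_le: "\<bar>b t \<omega>\<bar> \<le> 1" for t \<omega>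
    using PY.cdf_nonneg[of t] PY.cdf_bounded_prob[of t] by (auto simp: b_def jump_def F_eq)
  have a_fin: "(\<integral>\<^sup>+\<omega>. \<integral>\<^sup>+s. ennreal \<bar>a s \<omega>\<bar> \<partial>lborel \<partial>M) < \<infinity>"
    using PX.nn_integral_centred_jump_finite[OF intX]
    by (simp add: nn_integral_distr a_def F_eq)
  have b_fin: "(\<integral>\<^sup>+\<omega>. \<integral>\<^sup>+t. ennreal \<bar>b t \<omega>\<bar> \<partial>lborel \<partial>M) < \<infinity>"
    using PY.nn_integral_centred_jump_finite[OF intY]
    by (simp add: nn_integral_distr b_def F_eq)

  interpret MM: pair_prob_space M M ..
  interpret MML: pair_sigma_finite "M \<Otimes>\<^sub>M M" "lborel \<Otimes>\<^sub>M lborel :: (real \<times> real) measure"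
    by (intro pair_sigma_finite.intro MM.sigma_finite_measure_axioms
          lborel_pair.sigma_finite_measure_axioms)
  define \<phi> where
    "\<phi> = (\<lambda>(\<omega>1, \<omega>2) (s, t). (a s \<omega>1 * b t \<omega>1) * (a s \<omega>2 * b t \<omega>2))"
  have \<phi>_measurable [measurable]:
    "case_prod \<phi> \<in> borel_measurable ((M \<Otimes>\<^sub>M M) \<Otimes>\<^sub>M (lborel \<Otimes>\<^sub>M lborel))"
    unfolding \<phi>_def case_prod_unfold by measurable
  \<comment> \<open>Keep \<open>a\<close> at the first copy and \<open>b\<close> at the second, so that the bound factorises.\<close>
  have \<phi>_le: "\<bar>\<phi> w p\<bar> \<le> \<bar>a (fst p) (fst w)\<bar> * \<bar>b (snd p) (snd w)\<bar>" for w p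
  proof -
    have "\<bar>\<phi> w p\<bar> = (\<bar>a (fst p) (fst w)\<bar> * \<bar>b (snd p) (snd w)\<bar>)
                     * (\<bar>b (snd p) (fst w)\<bar> * \<bar>a (fst p) (snd w)\<bar>)"
      by (simp add: \<phi>_def case_prod_unfold abs_mult)
    also have "\<dots> \<le> (\<bar>a (fst p) (fst w)\<bar> * \<bar>b (snd p) (snd w)\<bar>) * (1 * 1)"
      by (intro mult_mono a_le b_le) auto
    finally show ?thesis by simp
  qed
  have "(\<integral>\<^sup>+p. ennreal (norm (case_prod \<phi> p)) \<partial>((M \<Otimes>\<^sub>M M) \<Otimes>\<^sub>M (lborel \<Otimes>\<^sub>M lborel)))
      = (\<integral>\<^sup>+w. \<integral>\<^sup>+p. ennreal \<bar>\<phi> w p\<bar> \<partial>(lborel \<Otimes>\<^sub>M lborel) \<partial>(M \<Otimes>\<^sub>M M))"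
    by (subst lborel_pair.P.nn_integral_fst[symmetric]) auto
  also have "\<dots> \<le> (\<integral>\<^sup>+w. \<integral>\<^sup>+p. ennreal \<bar>a (fst p) (fst w)\<bar> * ennreal \<bar>b (snd p) (snd w)\<bar>
                      \<partial>(lborel \<Otimes>\<^sub>M lborel) \<partial>(M \<Otimes>\<^sub>M M))"
    by (intro nn_integral_mono) (simp add: \<phi>_le ennreal_leI flip: ennreal_mult)
  also have "\<dots> = (\<integral>\<^sup>+w. (\<integral>\<^sup>+s. ennreal \<bar>a s (fst w)\<bar> \<partial>lborel)
                      * (\<integral>\<^sup>+t. ennreal \<bar>b t (snd w)\<bar> \<partial>lborel) \<partial>(M \<Otimes>\<^sub>M M))"
    by (intro nn_integral_cong, subst lborel.nn_integral_fst[symmetric])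
       (auto simp: nn_integral_cmult nn_integral_multc space_pair_measure)
  also have "\<dots> = (\<integral>\<^sup>+\<omega>. \<integral>\<^sup>+s. ennreal \<bar>a s \<omega>\<bar> \<partial>lborel \<partial>M)
                   * (\<integral>\<^sup>+\<omega>. \<integral>\<^sup>+t. ennreal \<bar>b t \<omega>\<bar> \<partial>lborel \<partial>M)"
    by (subst nn_integral_fst[symmetric]) (auto simp: nn_integral_cmult nn_integral_multc)
  also have "\<dots> < \<infinity>"
    using a_fin b_fin by (simp add: ennreal_mult_less_top)
  finally have \<phi>_int:
    "integrable ((M \<Otimes>\<^sub>M M) \<Otimes>\<^sub>M (lborel \<Otimes>\<^sub>M lborel)) (case_prod \<phi>)"
    by (intro integrableI_bounded) auto

  define D where "D s t = prob {\<omega> \<in> space M. X \<omega> \<le> s \<and> Y \<omega> \<le> t} - F s * F' t" for s t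
  have cov: "has_bochner_integral M (\<lambda>\<omega>. a s \<omega> * b t \<omega>) (D s t)" for s t
  proof -
    have X_s: "has_bochner_integral M (\<lambda>\<omega>. jump (X \<omega>) s) (F s)"
      using PX.has_integral_jump[of s]
      by (simp add: has_bochner_integral_iff integrable_distr_eq integral_distr F_eq)
    have Y_t: "has_bochner_integral M (\<lambda>\<omega>. jump (Y \<omega>) t) (F' t)"
      using PY.has_integral_jump[of t]
      by (simp add: has_bochner_integral_iff integrable_distr_eq integral_distr F_eq)
    have XY: "has_bochner_integral M (\<lambda>\<omega>. jump (X \<omega>) s * jump (Y \<omega>) t)
                     (prob {\<omega> \<in> space M. X \<omega> \<le> s \<and> Y \<omega> \<le> t})"
    proof -
      have "has_bochner_integral M (indicator {\<omega> \<in> space M. X \<omega> \<le> s \<and> Y \<omega> \<le> t} :: 'a \<Rightarrow> real)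
                     (prob {\<omega> \<in> space M. X \<omega> \<le> s \<and> Y \<omega> \<le> t})"
        by (rule has_bochner_integral_real_indicator) (auto simp: emeasure_eq_measure)
      then show ?thesis
        by (rule has_bochner_integral_cong[THEN iffD1, rotated 3]) (auto simp: jump_def)
    qed
    have const: "has_bochner_integral M (\<lambda>\<omega>. F s * F' t) (F s * F' t)"
      by (simp add: has_bochner_integral_iff prob_space)
    have "has_bochner_integral M
        (\<lambda>\<omega>. jump (X \<omega>) s * jump (Y \<omega>) t - F s * jump (Y \<omega>) t
              - jump (X \<omega>) s * F' t + F s * F' t)
        (prob {\<omega> \<in> space M. X \<omega> \<le> s \<and> Y \<omega> \<le> t} - F s * F' t - F s * F' t + F s * F' t)"
      by (intro has_bochner_integral_add[OF _ const] has_bochner_integral_diff XY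
            has_bochner_integral_mult_left[OF X_s] has_bochner_integral_mult_right[OF Y_t])
    then show ?thesis
      by (simp add: a_def b_def D_def algebra_simps)
  qed
  have inner: "(\<integral>w. \<phi> w p \<partial>(M \<Otimes>\<^sub>M M)) = (case p of (s, t) \<Rightarrow> (D s t)\<^sup>2)" for p
  proof -
    obtain s t where "p = (s, t)" by force
    then show ?thesis
      using MM.has_integral_product[of "\<lambda>\<omega>. a s \<omega> * b t \<omega>" "\<lambda>\<omega>. a s \<omega> * b t \<omega>"] cov[of s t]
      by (simp add: has_bochner_integral_iff \<phi>_def case_prod_unfold power2_eq_square)
  qed
  have "(\<integral>p. \<phi> w p \<partial>(lborel \<Otimes>\<^sub>M lborel))
       = (case w of (\<omega>1, \<omega>2) \<Rightarrow> bergsma_h F (X \<omega>1) (X \<omega>2) * bergsma_h F' (Y \<omega>1) (Y \<omega>2))" for w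
  proof -
    obtain \<omega>1 \<omega>2 where w: "w = (\<omega>1, \<omega>2)" by force
    have "has_bochner_integral lborel (\<lambda>s. a s \<omega>1 * a s \<omega>2) (bergsma_h F (X \<omega>1) (X \<omega>2))"
      using PX.bergsma_h_cdf[OF intX] by (simp add: a_def F_eq)
    moreover have "has_bochner_integral lborel (\<lambda>t. b t \<omega>1 * b t \<omega>2) (bergsma_h F' (Y \<omega>1) (Y \<omega>2))"
      using PY.bergsma_h_cdf[OF intY] by (simp add: b_def F_eq)
    ultimately show ?thesis
      using lborel_pair.has_integral_product[of "\<lambda>s. a s \<omega>1 * a s \<omega>2" "\<lambda>t. b t \<omega>1 * b t \<omega>2"]
      by (simp add: has_bochner_integral_iff w \<phi>_def case_prod_unfold mult_ac)
  qed
  then have outer: "(\<integral>w. (\<integral>p. \<phi> w p \<partial>(lborel \<Otimes>\<^sub>M lborel)) \<partial>(M \<Otimes>\<^sub>M M)) = bergsma_cov M X Y"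
    by (simp add: bergsma_cov_def F_def F'_def)
  show ?thesis
    using MML.integrable_snd[OF \<phi>_int] MML.Fubini_integral[OF \<phi>_int]
    by (simp add: has_bochner_integral_iff inner outer D_def)
qed

section \<open>Exponential integrals\<close>

lemma has_integral_exponential:
  assumes "0 < l"
  shows "has_bochner_integral lborel (\<lambda>t. indicator {0<..} t * exp (- (l * t))) (1 / l :: real)"
proof -
  interpret E: prob_space "density lborel (exponential_density l)"
    by (rule prob_space_exponential_density) fact
  have "(\<integral>\<^sup>+t. ennreal (exponential_density l t) \<partial>lborel) = ennreal 1"
    using E.emeasure_space_1 by (simp add: emeasure_density)
  then have "has_bochner_integral lborel (exponential_density l) 1"
    by (intro has_bochner_integral_nn_integral) (auto simp: exponential_density_nonneg assms)
  then have "has_bochner_integral lborel (\<lambda>t. (1 / l) * exponential_density l t) ((1 / l) * 1)"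
    by (rule has_bochner_integral_mult_right)
  moreover have "AE t in lborel. (1 / l) * exponential_density l t
                   = indicator {0<..} t * exp (- (l * t))"
    using AE_lborel_singleton[of 0]
    by eventually_elim (use assms in \<open>auto simp: exponential_density_def mult_ac\<close>)
  ultimately show ?thesis
    by (subst (asm) has_bochner_integral_cong_AE) auto
qed

text \<open>The substitution \<open>s = c * t - c\<close> maps \<open>t > 1\<close> onto \<open>s > 0\<close> and
  \<open>s + c\<close> to \<open>c * t\<close>, which produces the integral defining \<open>G\<close>.\<close>
lemma has_integral_exp_over_shift:
  assumes "0 < l" "0 < c"
  shows "has_bochner_integral lborel (\<lambda>s. indicator {0<..} s * (exp (- (l * s)) / (s + c)))
           (exp (l * c) * G (l * c))"
proof -
  define f :: "real \<Rightarrow> real" where "f s = indicator {0<..} s * (exp (- (l * s)) / (s + c))" for s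
  have [measurable]: "f \<in> borel_measurable borel"
    unfolding f_def by measurable
  have "integrable lborel (\<lambda>s. (1 / c) * (indicator {0<..} s * exp (- (l * s))))"
    using has_integral_exponential[OF assms(1)] by (auto simp: has_bochner_integral_iff)
  then have int: "integrable lborel f"
  proof (rule Bochner_Integration.integrable_bound)
    show "AE s in lborel. norm (f s) \<le> norm ((1 / c) * (indicator {0<..} s * exp (- (l * s))))"
      using assms by (intro AE_I2) (auto simp: f_def indicator_def frac_le)
  qed auto
  have "f (- c + c * t) = exp (l * c) / c * (indicator {1<..} t * (exp (- (l * c) * t) / t))" for t
    using assms by (auto simp: f_def indicator_def field_simps simp flip: exp_add)
  then have "(\<integral>s. f s \<partial>lborel)
      = c * (\<integral>t. exp (l * c) / c * (indicator {1<..} t * (exp (- (l * c) * t) / t)) \<partial>lborel)"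
    using assms by (subst lborel_integral_real_affine[of c _ "- c"]) auto
  also have "\<dots> = exp (l * c) * (\<integral>t. indicator {1<..} t * (exp (- (l * c) * t) / t) \<partial>lborel)"
    by (subst integral_mult_right_zero) (use assms in simp)
  also have "(\<integral>t. indicator {1<..} t * (exp (- (l * c) * t) / t) \<partial>lborel) = G (l * c)"
    by (simp add: G_def one_ereal_def interval_integral_to_infinity_eq set_lebesgue_integral_def)
  finally show ?thesis
    using int unfolding has_bochner_integral_iff f_def by blast
qed

section \<open>Gumbel's bivariate exponential distribution\<close>

lemma gumbel_distributed_commute:
  assumes "gumbel_distributed M X Y \<theta>"
  shows "gumbel_distributed M Y X \<theta>"
proof -
  have "gumbel_cdf \<theta> x y = gumbel_cdf \<theta> y x" for x y
    by (auto simp: gumbel_cdf_def mult_ac add_ac)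
  then show ?thesis
    using assms by (auto simp: gumbel_distributed_def conj_commute)
qed

text \<open>The marginal is the limit of the joint distribution function as the second argument tends to
  infinity; since \<open>\<theta> \<ge> 0\<close>, the mixed exponential is at most \<open>exp (- y)\<close> and
  vanishes in the limit.\<close>
lemma (in prob_space) gumbel_marginal:
  assumes "gumbel_distributed M X Y \<theta>" "0 \<le> \<theta>"
  shows "prob {\<omega> \<in> space M. X \<omega> \<le> x} = (if 0 < x then 1 - exp (- x) else 0)"
proof -
  have [measurable]: "X \<in> borel_measurable M" "Y \<in> borel_measurable M"
    and joint: "prob {\<omega> \<in> space M. X \<omega> \<le> x \<and> Y \<omega> \<le> y} = gumbel_cdf \<theta> x y" for x y
    using assms by (auto simp: gumbel_distributed_def)
  have "(\<lambda>n. prob {\<omega> \<in> space M. X \<omega> \<le> x \<and> Y \<omega> \<le> real n})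
        \<longlonglongrightarrow> prob (\<Union>n. {\<omega> \<in> space M. X \<omega> \<le> x \<and> Y \<omega> \<le> real n})"
    by (rule finite_Lim_measure_incseq) (auto simp: incseq_def)
  also have "(\<Union>n. {\<omega> \<in> space M. X \<omega> \<le> x \<and> Y \<omega> \<le> real n}) = {\<omega> \<in> space M. X \<omega> \<le> x}"
    using real_arch_simple by auto
  finally have "(\<lambda>n. gumbel_cdf \<theta> x (real n)) \<longlonglongrightarrow> prob {\<omega> \<in> space M. X \<omega> \<le> x}"
    by (simp add: joint)
  moreover have "(\<lambda>n. gumbel_cdf \<theta> x (real n)) \<longlonglongrightarrow> (if 0 < x then 1 - exp (- x) else 0)"
  proof (cases "0 < x")
    case True
    have "(\<lambda>n. exp (- real n)) \<longlonglongrightarrow> 0"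
      by real_asymp
    moreover have "(\<lambda>n. exp (- (x + real n + \<theta> * x * real n))) \<longlonglongrightarrow> 0"
    proof (rule tendsto_sandwich[OF _ _ tendsto_const \<open>(\<lambda>n. exp (- real n)) \<longlonglongrightarrow> 0\<close>])
      show "\<forall>\<^sub>F n in sequentially. exp (- (x + real n + \<theta> * x * real n)) \<le> exp (- real n)"
      proof (intro always_eventually allI)
        fix n
        have "0 \<le> \<theta> * x * real n"
          using True assms(2) by simp
        with True show "exp (- (x + real n + \<theta> * x * real n)) \<le> exp (- real n)"
          by simp
      qed
    qed auto
    ultimately have "(\<lambda>n. 1 - exp (- x) - exp (- real n) + exp (- (x + real n + \<theta> * x * real n)))
                       \<longlonglongrightarrow> 1 - exp (- x) - 0 + 0"
      by (intro tendsto_intros)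
    moreover have "\<forall>\<^sub>F n in sequentially. gumbel_cdf \<theta> x (real n)
        = 1 - exp (- x) - exp (- real n) + exp (- (x + real n + \<theta> * x * real n))"
      using eventually_gt_at_top[of 0] by eventually_elim (simp add: gumbel_cdf_def True)
    ultimately show ?thesis
      using True by (simp add: tendsto_cong)
  qed (simp add: gumbel_cdf_def)
  ultimately show ?thesis
    by (rule LIMSEQ_unique)
qed

lemma (in prob_space) gumbel_integrable:
  assumes "gumbel_distributed M X Y \<theta>" "0 \<le> \<theta>"
  shows "integrable M X"
proof -
  have [measurable]: "X \<in> borel_measurable M"
    using assms by (auto simp: gumbel_distributed_def)
  have "distributed M lborel X (exponential_density 1)"
    by (rule exponential_distributedI)
       (auto simp: emeasure_eq_measure gumbel_marginal[OF assms] ennreal_minus simp flip: ennreal_1)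
  then have "expectation X = 1"
    using exponential_distributed_expectation[of 1 X] by simp
  \<comment> \<open>A Bochner integral with a value other than the default 0 certifies integrability.\<close>
  then show ?thesis
    using not_integrable_integral_eq[of M X] by auto
qed

theorem mainTheorem2:
  fixes M :: "'a measure" and X Y :: "'a \<Rightarrow> real" and \<theta> :: real
  assumes "prob_space M"
    and "0 \<le> \<theta>" and "\<theta> \<le> 1"
    and "gumbel_distributed M X Y \<theta>"
  shows "bergsma_cov M X Y =
    (if \<theta> = 0 then 0
     else 1 / (2 * \<theta>) * exp (2 / \<theta>) * G (2 / \<theta>) + 1 / 4
          - 2 / \<theta> * exp (4 / \<theta>) * G (4 / \<theta>))"
proof -
  interpret prob_space M by fact
  note gumbel = assms(4) gumbel_distributed_commute[OF assms(4)]
  have [measurable]: "X \<in> borel_measurable M" "Y \<in> borel_measurable M"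
    and joint: "prob {\<omega> \<in> space M. X \<omega> \<le> s \<and> Y \<omega> \<le> t} = gumbel_cdf \<theta> s t" for s t
    using assms(4) by (auto simp: gumbel_distributed_def)
  have df: "distribution_function M X s = (if 0 < s then 1 - exp (- s) else 0)"
    "distribution_function M Y s = (if 0 < s then 1 - exp (- s) else 0)" for s
    using gumbel[THEN gumbel_marginal, OF assms(2), of s]
    by (auto simp: distribution_function_def cdf_def measure_distr vimage_def Int_def conj_commute)
  define D where "D s t = (if 0 < s \<and> 0 < t
      then exp (- (s + t + \<theta> * s * t)) - exp (- (s + t)) else 0)" for s t
  have "prob {\<omega> \<in> space M. X \<omega> \<le> s \<and> Y \<omega> \<le> t}
        - distribution_function M X s * distribution_function M Y t = D s t" for s t
    by (auto simp: joint df gumbel_cdf_def D_def algebra_simps mult_exp_exp)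
  then have kappa: "has_bochner_integral (lborel \<Otimes>\<^sub>M lborel) (\<lambda>(s, t). (D s t)\<^sup>2) (bergsma_cov M X Y)"
    using bergsma_cov_eq_integral_square[OF gumbel[THEN gumbel_integrable, OF assms(2)]] by simp
  show ?thesis
  proof (cases "\<theta> = 0")
    case True
    then have "D = (\<lambda>s t. 0)"
      by (auto simp: D_def fun_eq_iff)
    with kappa True show ?thesis
      by (simp add: has_bochner_integral_iff case_prod_unfold)
  next
    case False
    with assms(2) have pos: "0 < \<theta>" by simp
    \<comment> \<open>Expanding the square gives exponentials in \<open>t\<close> with rates
      \<open>2 + 2 \<theta> s\<close>, \<open>2 + \<theta> s\<close> and \<open>2\<close>.\<close>
    have inner: "(\<integral>t. (D s t)\<^sup>2 \<partial>lborel)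
        = 1 / (2 * \<theta>) * (indicator {0<..} s * (exp (- (2 * s)) / (s + 1 / \<theta>)))
          - 2 / \<theta> * (indicator {0<..} s * (exp (- (2 * s)) / (s + 2 / \<theta>)))
          + 1 / 2 * (indicator {0<..} s * exp (- (2 * s)))" for s
    proof (cases "0 < s")
      case True
      let ?e = "\<lambda>l t. indicator {0<..} t * exp (- (l * t)) :: real"
      have l: "0 < 2 + 2 * \<theta> * s" "0 < 2 + \<theta> * s"
        using True pos by (auto intro!: add_pos_pos)
      have "has_bochner_integral lborel
          (\<lambda>t. exp (- (2 * s)) * (?e (2 + 2 * \<theta> * s) t - 2 * ?e (2 + \<theta> * s) t + ?e 2 t))
          (exp (- (2 * s)) * (1 / (2 + 2 * \<theta> * s) - 2 * (1 / (2 + \<theta> * s)) + 1 / 2))"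
        by (intro has_bochner_integral_mult_right has_bochner_integral_add
              has_bochner_integral_diff has_integral_exponential l) simp
      moreover have "(D s t)\<^sup>2
          = exp (- (2 * s)) * (?e (2 + 2 * \<theta> * s) t - 2 * ?e (2 + \<theta> * s) t + ?e 2 t)" for t
        using True by (auto simp: D_def indicator_def power2_eq_square algebra_simps simp flip: exp_add)
      ultimately have "(\<integral>t. (D s t)\<^sup>2 \<partial>lborel)
          = exp (- (2 * s)) * (1 / (2 + 2 * \<theta> * s) - 2 * (1 / (2 + \<theta> * s)) + 1 / 2)"
        by (simp add: has_bochner_integral_iff)
      moreover have "1 / (2 + 2 * \<theta> * s) = 1 / (2 * \<theta>) * (1 / (s + 1 / \<theta>))"
        "2 * (1 / (2 + \<theta> * s)) = 2 / \<theta> * (1 / (s + 2 / \<theta>))"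
        using pos by (simp_all add: field_simps)
      ultimately show ?thesis
        using True by (simp add: algebra_simps)
    qed (simp add: D_def)
    have "has_bochner_integral lborel (\<lambda>s. \<integral>t. (D s t)\<^sup>2 \<partial>lborel)
        (1 / (2 * \<theta>) * (exp (2 * (1 / \<theta>)) * G (2 * (1 / \<theta>)))
         - 2 / \<theta> * (exp (2 * (2 / \<theta>)) * G (2 * (2 / \<theta>))) + 1 / 2 * (1 / 2))"
      unfolding inner using pos
      by (intro has_bochner_integral_mult_right has_bochner_integral_add
            has_bochner_integral_diff has_integral_exp_over_shift has_integral_exponential) auto
    moreover have "(\<integral>s. (\<integral>t. (D s t)\<^sup>2 \<partial>lborel) \<partial>lborel) = bergsma_cov M X Y"
      using kappa lborel_pair.integral_fst[of "\<lambda>s t. (D s t)\<^sup>2"]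
      by (simp add: has_bochner_integral_iff)
    ultimately show ?thesis
      using False by (simp add: has_bochner_integral_iff)
  qed
qed
end
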